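(* Let $G$ be a countable locally finite group. Then $$\mathcal E(G) = \left\{\frac{\log(n)}{|H|} : H \text{ a finite subgroup of } G,\ n \in \mathbb N\right\}.$$
   Context: Here $\mathbb N = \{1,2,3,\dots\}$. A group is locally finite if each of its finitely generated subgroups is finite; countable locally finite groups are amenable. A (left) F{\o}lner sequence for $G$ is a sequence $\{F_n\}_{n\ge1}$ of nonempty finite subsets of $G$ with $G = \bigcup_n F_n$ and $\lim_{n} |gF_n \triangle F_n|/|F_n| = 0$ for all $g \in G$. For a finite set (alphabet) $\mathcal A$ with the discrete topology, $\mathcal A^G$ carries the product topology, and $G$ acts on it by $(\sigma^g x)(h) = x(hg)$. A $G$-shift (of $\mathcal A^G$) is a closed subset $X \subset \mathcal A^G$ with $\sigma^g x \in X$ for all $x \in X$, $g \in G$. For $F \subset G$, $\mathcal L_F(X) = \{x|_F : x \in X\}$. A finite pattern is an element of $\mathcal A^F$ with $F \subset G$ finite. For a set $\mathbf F$ of finite patterns, $\mathcal X^G[\mathbf F] = \{x \in \mathcal A^G : (\sigma^g x)|_F \notin \mathbf F \text{ for all } g \in G \text{ and all } F \subset G\}$. A $G$-shift $X$ is a $G$-SFT if $X = \mathcal X^G[\mathbf F]$ for some finite set $\mathbf F$ of finite patterns. For a nonempty $G$-shift $X$, $h(X) = \lim_{n\to\infty} \log(|\mathcal L_{F_n}(X)|)/|F_n|$ for any F{\o}lner sequence $\{F_n\}$ (the limit exists and is independent of the sequence). $\mathcal E(G) = \{h(X) : X \text{ a nonempty } G\text{-SFT}\}$, over all finite alphabets.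 *)

theory Defs
  imports
    "HOL-Analysis.Analysis"
    "HOL-Algebra.Generated_Groups"
begin

definition locally_finite :: "('g, 'm) monoid_scheme \<Rightarrow> bool" where
  "locally_finite G \<longleftrightarrow>
     (\<forall>S. S \<subseteq> carrier G \<and> finite S \<longrightarrow> finite (generate G S))"

text \<open>The sequence is indexed from 0.\<close>

definition folner_sequence :: "('g, 'm) monoid_scheme \<Rightarrow> (nat \<Rightarrow> 'g set) \<Rightarrow> bool" where
  "folner_sequence G F \<longleftrightarrow>
     (\<forall>n. F n \<noteq> {} \<and> finite (F n) \<and> F n \<subseteq> carrier G) \<and>
     (\<Union>n. F n) = carrier G \<and>
     (\<forall>g\<in>carrier G.
        (\<lambda>n. real (card (sym_diff (g <#\<^bsub>G\<^esub> F n) (F n))) / real (card (F n))) \<longlonglongrightarrow> 0)"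

text \<open>
  The space of configurations over an alphabet \<open>A\<close> is \<open>carrier G \<rightarrow>\<^sub>E A\<close>,
  the underlying set of the topology \<open>full_shift G A\<close>.
\<close>

definition full_shift :: "('g, 'm) monoid_scheme \<Rightarrow> 'a set \<Rightarrow> ('g \<Rightarrow> 'a) topology" where
  "full_shift G A = product_topology (\<lambda>_. discrete_topology A) (carrier G)"

definition shift_map :: "('g, 'm) monoid_scheme \<Rightarrow> 'g \<Rightarrow> ('g \<Rightarrow> 'a) \<Rightarrow> ('g \<Rightarrow> 'a)" where
  "shift_map G g x = (\<lambda>h\<in>carrier G. x (h \<otimes>\<^bsub>G\<^esub> g))"

definition is_shift :: "('g, 'm) monoid_scheme \<Rightarrow> 'a set \<Rightarrow> ('g \<Rightarrow> 'a) set \<Rightarrow> bool" where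
  "is_shift G A X \<longleftrightarrow>
     closedin (full_shift G A) X \<and> (\<forall>x\<in>X. \<forall>g\<in>carrier G. shift_map G g x \<in> X)"

definition language :: "'g set \<Rightarrow> ('g \<Rightarrow> 'a) set \<Rightarrow> ('g \<Rightarrow> 'a) set" where
  "language F X = (\<lambda>x. restrict x F) ` X"

text \<open>
  A pattern carries its domain explicitly: an element of \<open>F \<rightarrow>\<^sub>E A\<close> alone does not
  determine \<open>F\<close>, because \<open>undefined\<close> may belong to \<open>A\<close>.
\<close>

definition finite_patterns ::
    "('g, 'm) monoid_scheme \<Rightarrow> 'a set \<Rightarrow> ('g set \<times> ('g \<Rightarrow> 'a)) set" where
  "finite_patterns G A = {(F, p). F \<subseteq> carrier G \<and> finite F \<and> p \<in> F \<rightarrow>\<^sub>E A}"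

definition avoiding ::
    "('g, 'm) monoid_scheme \<Rightarrow> 'a set \<Rightarrow> ('g set \<times> ('g \<Rightarrow> 'a)) set \<Rightarrow> ('g \<Rightarrow> 'a) set" where
  "avoiding G A P =
     {x \<in> carrier G \<rightarrow>\<^sub>E A.
        \<forall>g\<in>carrier G. \<forall>F. F \<subseteq> carrier G \<longrightarrow> (F, restrict (shift_map G g x) F) \<notin> P}"

definition is_SFT :: "('g, 'm) monoid_scheme \<Rightarrow> 'a set \<Rightarrow> ('g \<Rightarrow> 'a) set \<Rightarrow> bool" where
  "is_SFT G A X \<longleftrightarrow>
     is_shift G A X \<and> (\<exists>P. finite P \<and> P \<subseteq> finite_patterns G A \<and> X = avoiding G A P)"

definition entropy :: "('g, 'm) monoid_scheme \<Rightarrow> ('g \<Rightarrow> 'a) set \<Rightarrow> real" where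
  "entropy G X =
     (THE h. \<forall>F. folner_sequence G F \<longrightarrow>
        (\<lambda>n. ln (real (card (language (F n) X))) / real (card (F n))) \<longlonglongrightarrow> h)"

text \<open>
  Every finite alphabet is in bijection with a finite set of natural numbers, and
  renaming the letters does not change the entropy.
\<close>

definition SFT_entropies :: "('g, 'm) monoid_scheme \<Rightarrow> real set" where
  "SFT_entropies G =
     {entropy G X | (A :: nat set) X. finite A \<and> is_SFT G A X \<and> X \<noteq> {}}"

end

theory Submission imports Defs begin

text \<open>
  The finitely many forbidden patterns of an SFT have finite domains, and local finiteness puts
  all these domains into one finite subgroup \<open>H\<close>. Since \<open>(\<sigma>\<^sup>g x)|\<^sub>H\<close> reads off \<open>x\<close> on the right
  coset \<open>Hg\<close>, every constraint then lives inside a single right coset: \<open>x\<close> is admissible if and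
  only if each of its coset blocks lies in a fixed set \<open>W\<close> of allowed patterns on \<open>H\<close>
  (lemma \<open>avoiding_eq_block_shift\<close>). A coset has no preferred base point, so \<open>W\<close> has to be
  invariant under the right translations of \<open>H\<close>; under this condition different cosets do not
  interact at all, the SFT is a product of copies of \<open>W\<close>, one for each right coset, and a union of
  \<open>k\<close> right cosets carries exactly \<open>|W|\<^sup>k\<close> patterns (lemma \<open>card_language_cosets\<close>).

  For a left Folner sequence \<open>hF\<^sub>n\<close> and \<open>F\<^sub>n\<close> nearly agree for every \<open>h\<close> in \<open>H\<close>, which means that
  \<open>F\<^sub>n\<close> is nearly a union of right cosets of \<open>H\<close>. Comparing \<open>F\<^sub>n\<close> with the union of the cosets
  inside it and with the union of the cosets meeting it gives the entropy \<open>ln |W| / |H|\<close>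
  (lemmas \<open>card_language_bounds\<close> and \<open>entropy_block_shift\<close>). As the entropy is defined by its
  value along all Folner sequences, the existence of one such sequence is needed for
  uniqueness; the subgroups generated by initial segments of an enumeration of the group provide
  it.

  This gives one inclusion with \<open>n = |W|\<close>. For the other, given \<open>H\<close> and \<open>n\<close>, let \<open>W\<close> consist of the
  \<open>n\<close> constant patterns on \<open>H\<close>: they are invariant, and the configurations that are constant on
  every right coset form an SFT, because the non-constant patterns on \<open>H\<close> are finitely many.
\<close>

section \<open>Subshifts determined by blocks on the cosets of a subgroup\<close>

definition block_shift :: "('g, 'm) monoid_scheme \<Rightarrow> 'a set \<Rightarrow> 'g set \<Rightarrow> ('g \<Rightarrow> 'a) set \<Rightarrow> ('g \<Rightarrow> 'a) set" where
  "block_shift G A H W =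
     {x \<in> carrier G \<rightarrow>\<^sub>E A. \<forall>g\<in>carrier G. restrict (shift_map G g x) H \<in> W}"

text \<open>
  The effect on the block over \<open>Hg\<close> of replacing the base point \<open>g\<close> by another point \<open>kg\<close> of the
  same coset must stay within the allowed blocks; otherwise the block condition at one point of the
  coset would not imply it at the others.
\<close>

definition shift_invariant :: "('g, 'm) monoid_scheme \<Rightarrow> 'g set \<Rightarrow> ('g \<Rightarrow> 'a) set \<Rightarrow> bool" where
  "shift_invariant G H W \<longleftrightarrow> (\<forall>w\<in>W. \<forall>k\<in>H. (\<lambda>h\<in>H. w (h \<otimes>\<^bsub>G\<^esub> k)) \<in> W)"

context group begin

lemma shift_map_mult:
  assumes "g \<in> carrier G" "k \<in> carrier G"
  shows "shift_map G k (shift_map G g x) = shift_map G (k \<otimes> g) x"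
  using assms by (auto simp: shift_map_def m_assoc fun_eq_iff)

lemma shift_map_in_PiE:
  assumes "x \<in> carrier G \<rightarrow>\<^sub>E A" "g \<in> carrier G"
  shows "shift_map G g x \<in> carrier G \<rightarrow>\<^sub>E A"
  using assms by (auto simp: shift_map_def)

text \<open>
  Forbidding a pattern with finite domain at a given position removes a cylinder, that is, a finite
  intersection of preimages of points under coordinate projections, and these are open.
\<close>

lemma is_shift_avoiding:
  assumes P: "P \<subseteq> finite_patterns G A"
  shows "is_shift G A (avoiding G A P)"
proof -
  let ?T = "full_shift G A"
  have top: "topspace ?T = carrier G \<rightarrow>\<^sub>E A"
    by (simp add: full_shift_def)
  have cyl: "openin ?T {x \<in> carrier G \<rightarrow>\<^sub>E A. restrict (shift_map G g x) F = p}"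
    if g: "g \<in> carrier G" and Fp: "(F, p) \<in> P" for g F p
  proof -
    have F: "F \<subseteq> carrier G" "finite F" "p \<in> F \<rightarrow>\<^sub>E A"
      using P Fp by (auto simp: finite_patterns_def)
    have coord: "openin ?T {x \<in> topspace ?T. x (f \<otimes> g) \<in> {p f}}" if "f \<in> F" for f
    proof (rule openin_continuous_map_preimage)
      show "continuous_map ?T (discrete_topology A) (\<lambda>x. x (f \<otimes> g))"
        unfolding full_shift_def using that F g
        by (intro continuous_map_product_projection) auto
      show "openin (discrete_topology A) {p f}"
        using that F by auto
    qed
    have "{x \<in> carrier G \<rightarrow>\<^sub>E A. restrict (shift_map G g x) F = p} =
          topspace ?T \<inter> (\<Inter>f\<in>F. {x \<in> topspace ?T. x (f \<otimes> g) \<in> {p f}})"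
    proof -
      have "restrict (shift_map G g x) F = p \<longleftrightarrow> (\<forall>f\<in>F. x (f \<otimes> g) = p f)" for x
      proof
        assume "restrict (shift_map G g x) F = p"
        then show "\<forall>f\<in>F. x (f \<otimes> g) = p f" using F(1) by (auto simp: shift_map_def)
      next
        assume "\<forall>f\<in>F. x (f \<otimes> g) = p f"
        then show "restrict (shift_map G g x) F = p"
          using F(1,3) by (intro extensionalityI[of _ F]) (auto simp: shift_map_def PiE_def)
      qed
      then show ?thesis unfolding top by auto
    qed
    moreover have "openin ?T (topspace ?T \<inter> (\<Inter>f\<in>F. {x \<in> topspace ?T. x (f \<otimes> g) \<in> {p f}}))"
    proof (cases "F = {}")
      case False
      then show ?thesis using F coord by (intro openin_Int openin_topspace openin_INT2) auto
    qed auto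
    ultimately show ?thesis by simp
  qed
  have "topspace ?T - avoiding G A P =
        (\<Union>g\<in>carrier G. \<Union>(F, p)\<in>P. {x \<in> carrier G \<rightarrow>\<^sub>E A. restrict (shift_map G g x) F = p})"
    (is "?L = ?R")
  proof (intro equalityI subsetI)
    fix x assume "x \<in> ?L"
    then show "x \<in> ?R" unfolding top avoiding_def by blast
  next
    fix x assume "x \<in> ?R"
    then obtain g F where "g \<in> carrier G" "x \<in> carrier G \<rightarrow>\<^sub>E A"
      "(F, restrict (shift_map G g x) F) \<in> P" by blast
    moreover from this have "F \<subseteq> carrier G" using P by (auto simp: finite_patterns_def)
    ultimately show "x \<in> ?L" unfolding top avoiding_def by blast
  qed
  also have "openin ?T \<dots>"
    using cyl by (intro openin_Union) (auto intro!: openin_Union)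
  finally have "closedin ?T (avoiding G A P)"
    unfolding closedin_def top by (auto simp: avoiding_def)
  moreover have "shift_map G g x \<in> avoiding G A P"
    if "x \<in> avoiding G A P" "g \<in> carrier G" for x g
    using that shift_map_in_PiE[of x A g]
    by (auto simp: avoiding_def shift_map_mult)
  ultimately show ?thesis by (simp add: is_shift_def)
qed

text \<open>
  The complement of \<open>W\<close> among the patterns on \<open>H\<close> is a finite set of forbidden patterns.
\<close>

lemma is_SFT_block_shift:
  assumes "subgroup H G" "finite H" "finite A"
  shows "is_SFT G A (block_shift G A H W)"
proof -
  define P where "P = {H} \<times> ((H \<rightarrow>\<^sub>E A) - W)"
  have H: "H \<subseteq> carrier G" using assms subgroup.subset by blast
  have P: "P \<subseteq> finite_patterns G A" "finite P"
    using assms H by (auto simp: P_def finite_patterns_def intro: finite_PiE)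
  have "restrict (shift_map G g x) H \<in> H \<rightarrow>\<^sub>E A"
    if "x \<in> carrier G \<rightarrow>\<^sub>E A" "g \<in> carrier G" for x g
    using shift_map_in_PiE[OF that] H by auto
  then have eq: "block_shift G A H W = avoiding G A P"
    using H by (auto simp: block_shift_def avoiding_def P_def)
  show ?thesis
    unfolding is_SFT_def eq using is_shift_avoiding[OF P(1)] P by blast
qed

text \<open>
  \<open>H\<close> is generated by all the pattern domains. A block is allowed when no forbidden pattern occurs
  in it at any position of \<open>H\<close>; testing all positions, not only the identity, is what makes the set
  of allowed blocks invariant. It costs nothing, because the configuration is tested at all group
  elements anyway.
\<close>

lemma avoiding_eq_block_shift:
  assumes lf: "locally_finite G" and P: "finite P" "P \<subseteq> finite_patterns G A"
  obtains H W where "subgroup H G" "finite H" "W \<subseteq> H \<rightarrow>\<^sub>E A" "shift_invariant G H W"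
    "avoiding G A P = block_shift G A H W"
proof -
  define K where "K = (\<Union>(F, p)\<in>P. F)"
  define H where "H = generate G K"
  have K: "K \<subseteq> carrier G" "finite K"
    using P by (auto simp: K_def finite_patterns_def)
  have sub: "subgroup H G" unfolding H_def using K by (intro generate_is_subgroup) auto
  have fin: "finite H" using lf K by (auto simp: locally_finite_def H_def)
  have Hc: "H \<subseteq> carrier G" using sub subgroup.subset by blast
  have dom: "F \<subseteq> H" if "(F, p) \<in> P" for F p
    using that by (auto simp: H_def K_def intro!: generate.incl)
  define W where "W = {w \<in> H \<rightarrow>\<^sub>E A. \<forall>k\<in>H. \<forall>F p. (F, p) \<in> P \<longrightarrow> (\<lambda>f\<in>F. w (f \<otimes> k)) \<noteq> p}"
  have one: "\<one> \<in> H" by (rule subgroup.one_closed[OF sub])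
  have mult: "a \<otimes> b \<in> H" if "a \<in> H" "b \<in> H" for a b
    using that by (rule subgroup.m_closed[OF sub])
  have inv: "shift_invariant G H W"
    unfolding shift_invariant_def
  proof (intro ballI)
    fix w k assume w: "w \<in> W" and k: "k \<in> H"
    have "(\<lambda>h\<in>H. w (h \<otimes> k)) \<in> H \<rightarrow>\<^sub>E A"
      using w k mult by (auto simp: W_def)
    moreover have "(\<lambda>f\<in>F. (\<lambda>h\<in>H. w (h \<otimes> k)) (f \<otimes> k')) \<noteq> p"
      if "(F, p) \<in> P" "k' \<in> H" for F p k'
    proof -
      have "(\<lambda>f\<in>F. (\<lambda>h\<in>H. w (h \<otimes> k)) (f \<otimes> k')) = (\<lambda>f\<in>F. w (f \<otimes> (k' \<otimes> k)))"
        using dom[OF that(1)] that Hc k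
        by (intro restrict_ext) (simp add: subset_iff mult m_assoc)
      then show ?thesis using w that mult[OF that(2) k] unfolding W_def by fastforce
    qed
    ultimately show "(\<lambda>h\<in>H. w (h \<otimes> k)) \<in> W"
      unfolding W_def by blast
  qed
  have eq: "avoiding G A P = block_shift G A H W"
  proof (intro equalityI subsetI)
    fix x assume x: "x \<in> avoiding G A P"
    have "restrict (shift_map G g x) H \<in> W" if g: "g \<in> carrier G" for g
    proof -
      have "restrict (shift_map G g x) H \<in> H \<rightarrow>\<^sub>E A"
        using x g Hc shift_map_in_PiE[of x A g] by (auto simp: avoiding_def)
      moreover have "(\<lambda>f\<in>F. restrict (shift_map G g x) H (f \<otimes> k)) \<noteq> p"
        if "(F, p) \<in> P" "k \<in> H" for F p k
      proof -
        have "(\<lambda>f\<in>F. restrict (shift_map G g x) H (f \<otimes> k)) = restrict (shift_map G (k \<otimes> g) x) F"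
          using dom[OF that(1)] that Hc g
          by (intro restrict_ext) (simp add: subset_iff mult m_assoc shift_map_def)
        moreover have "F \<subseteq> carrier G" "k \<otimes> g \<in> carrier G" using dom[OF that(1)] that Hc g by auto
        ultimately show ?thesis using x that by (auto simp: avoiding_def)
      qed
      ultimately show ?thesis unfolding W_def by blast
    qed
    then show "x \<in> block_shift G A H W"
      using x by (auto simp: block_shift_def avoiding_def)
  next
    fix x assume x: "x \<in> block_shift G A H W"
    have False if g: "g \<in> carrier G" and Fp: "(F, restrict (shift_map G g x) F) \<in> P" for g F
    proof -
      have "restrict (shift_map G g x) H \<in> W" using x g by (auto simp: block_shift_def)
      then have "(\<lambda>f\<in>F. restrict (shift_map G g x) H (f \<otimes> \<one>)) \<noteq> restrict (shift_map G g x) F"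
        using one Fp by (auto simp: W_def)
      moreover have "(\<lambda>f\<in>F. restrict (shift_map G g x) H (f \<otimes> \<one>)) = restrict (shift_map G g x) F"
        using dom[OF Fp] Hc by (intro restrict_ext) (simp add: subset_iff)
      ultimately show False by blast
    qed
    then show "x \<in> avoiding G A P"
      using x by (auto simp: block_shift_def avoiding_def)
  qed
  show ?thesis
    by (rule that[OF sub fin _ inv eq]) (auto simp: W_def)
qed

section \<open>Counting patterns\<close>

lemma card_language_mono:
  assumes "F \<subseteq> F'" "finite (language F' X)"
  shows "card (language F X) \<le> card (language F' X)"
proof -
  have "language F X = (\<lambda>z. restrict z F) ` language F' X"
    using assms(1) by (simp add: language_def image_image Int_absorb1)
  then show ?thesis using assms(2) by (simp add: card_image_le)
qed

text \<open>
  After the choice of a base point in each coset, a pattern on a union of cosets amounts to a family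
  of blocks. All families in \<open>W\<close> occur: the blocks can be glued along the partition of the
  group into cosets, and invariance of \<open>W\<close> makes the result satisfy the block condition also at the
  points other than the chosen ones.
\<close>

lemma card_language_cosets:
  fixes A :: "'c set"
  assumes H: "subgroup H G"
    and W: "W \<subseteq> H \<rightarrow>\<^sub>E A" "W \<noteq> {}" "shift_invariant G H W"
    and C: "\<C> \<subseteq> rcosets H" "finite \<C>"
  shows "card (language (\<Union>\<C>) (block_shift G A H W)) = card W ^ card \<C>"
proof -
  let ?X = "block_shift G A H W"
  interpret H: subgroup H G by fact
  define r where "r C = (SOME a. a \<in> carrier G \<and> C = H #> a)" for C
  have r: "r C \<in> carrier G" "C = H #> r C" if "C \<in> rcosets H" for C
  proof -
    have "\<exists>a. a \<in> carrier G \<and> C = H #> a" using that by (auto simp: RCOSETS_def)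
    then show "r C \<in> carrier G" "C = H #> r C"
      unfolding r_def by (metis (mono_tags, lifting) someI_ex)+
  qed
  have repr: "H #> (h \<otimes> a) = H #> a" if "h \<in> H" "a \<in> carrier G" for h a
    using that by (metis H.subset H coset_join2 coset_mult_assoc in_mono H.mem_carrier)
  define \<Phi> where "\<Phi> z = (\<lambda>C\<in>\<C>. \<lambda>h\<in>H. z (h \<otimes> r C))" for z :: "'a \<Rightarrow> 'c"
  have mem: "h \<otimes> r C \<in> C" if "C \<in> \<C>" "h \<in> H" for C h
    using r[of C] C that by (auto simp: r_coset_def)
  have "bij_betw \<Phi> (language (\<Union>\<C>) ?X) (\<C> \<rightarrow>\<^sub>E W)"
    unfolding bij_betw_def
  proof (intro conjI equalityI subsetI)
    show "inj_on \<Phi> (language (\<Union>\<C>) ?X)"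
    proof (rule inj_onI)
      fix z z' assume z: "z \<in> language (\<Union>\<C>) ?X" "z' \<in> language (\<Union>\<C>) ?X" and eq: "\<Phi> z = \<Phi> z'"
      have "z u = z' u" for u
      proof (cases "u \<in> \<Union>\<C>")
        case True
        then obtain D where D: "D \<in> \<C>" "u \<in> D" by blast
        then obtain h where h: "h \<in> H" "u = h \<otimes> r D"
          using r[of D] C by (auto simp: r_coset_def)
        have "\<Phi> z D h = \<Phi> z' D h" using eq by simp
        then show ?thesis using h D by (simp add: \<Phi>_def)
      next
        case False
        then show ?thesis using z by (auto simp: language_def)
      qed
      then show "z = z'" by blast
    qed
  next
    fix y assume "y \<in> \<Phi> ` language (\<Union>\<C>) ?X"
    then obtain x where x: "x \<in> ?X" and y: "y = \<Phi> (restrict x (\<Union>\<C>))"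
      by (auto simp: language_def)
    have "(\<lambda>h\<in>H. restrict x (\<Union>\<C>) (h \<otimes> r D)) \<in> W" if D: "D \<in> \<C>" for D
    proof -
      have "(\<lambda>h\<in>H. restrict x (\<Union>\<C>) (h \<otimes> r D)) = restrict (shift_map G (r D) x) H"
        using mem[OF D] D by (intro restrict_ext) (auto simp: shift_map_def)
      then show ?thesis using x r[of D] D C by (auto simp: block_shift_def)
    qed
    then show "y \<in> \<C> \<rightarrow>\<^sub>E W" by (auto simp: y \<Phi>_def)
  next
    fix y assume y: "y \<in> \<C> \<rightarrow>\<^sub>E W"
    \<comment> \<open>The cosets outside the given family receive an arbitrary allowed block \<open>w0\<close>.\<close>
    obtain w0 where w0: "w0 \<in> W" using W by blast
    define v where "v D = (if D \<in> \<C> then y D else w0)" for D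
    have v: "v D \<in> W" for D using y w0 by (auto simp: v_def)
    define x where "x = (\<lambda>u\<in>carrier G. v (H #> u) (u \<otimes> inv (r (H #> u))))"
    have div: "u \<otimes> inv (r (H #> u)) \<in> H" if "u \<in> carrier G" for u
    proof -
      have D: "H #> u \<in> rcosets H" using that by (auto simp: RCOSETS_def)
      have "u \<in> H #> r (H #> u)" using r(2)[OF D] rcos_self[OF that H] by simp
      then obtain h where h: "h \<in> H" "u = h \<otimes> r (H #> u)" by (auto simp: r_coset_def)
      then have "u \<otimes> inv (r (H #> u)) = h"
        using r(1)[OF D] that by (intro iffD2[OF inv_solve_right']) auto
      then show ?thesis using h by simp
    qed
    have blk: "restrict (shift_map G g x) H \<in> W" if g: "g \<in> carrier G" for g
    proof -
      \<comment> \<open>Reading from \<open>g\<close> instead of the base point translates the block by \<open>?k \<in> H\<close>.\<close>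
      let ?D = "H #> g"
      let ?k = "g \<otimes> inv (r ?D)"
      have D: "?D \<in> rcosets H" using g by (auto simp: RCOSETS_def)
      have "restrict (shift_map G g x) H = (\<lambda>h\<in>H. v ?D (h \<otimes> ?k))"
        using g r(1)[OF D] by (intro restrict_ext) (simp add: shift_map_def x_def repr m_assoc)
      then show ?thesis using W(3) v div[OF g] by (auto simp: shift_invariant_def)
    qed
    have "x \<in> carrier G \<rightarrow>\<^sub>E A"
      using W(1) v div by (fastforce simp: x_def)
    with blk have x: "x \<in> ?X" by (auto simp: block_shift_def)
    have "\<Phi> (restrict x (\<Union>\<C>)) D = y D" for D
    proof (cases "D \<in> \<C>")
      case True
      then have D: "D \<in> rcosets H" using C by auto
      have "(\<lambda>h\<in>H. restrict x (\<Union>\<C>) (h \<otimes> r D)) = restrict (y D) H"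
        using mem[OF True] True r[OF D]
        by (intro restrict_ext) (auto simp: x_def repr v_def m_assoc)
      moreover have "restrict (y D) H = y D"
        using y True W(1) by (intro PiE_restrict[of _ _ "\<lambda>_. A"]) auto
      ultimately show ?thesis using True by (simp add: \<Phi>_def)
    next
      case False
      then show ?thesis using y by (auto simp: \<Phi>_def)
    qed
    then have "y = \<Phi> (restrict x (\<Union>\<C>))" by auto
    then show "y \<in> \<Phi> ` language (\<Union>\<C>) ?X" using x by (auto simp: language_def)
  qed
  then show ?thesis
    using C by (simp add: bij_betw_same_card card_funcsetE)
qed

lemma card_Union_rcosets:
  assumes "subgroup H G" "finite H" "\<C> \<subseteq> rcosets H"
  shows "card (\<Union>\<C>) = card H * card \<C>"
proof -
  have "card (\<Union>\<C>) = (\<Sum>C\<in>\<C>. card C)"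
  proof (rule card_Union_disjoint)
    show "disjoint \<C>"
      using rcos_disjoint[OF assms(1)] assms(3) by (auto simp: pairwise_def disjnt_def)
    show "finite C" if "C \<in> \<C>" for C
      using that assms rcosets_finite[of C H] subgroup.subset[OF assms(1)] by blast
  qed
  also have "\<dots> = (\<Sum>C\<in>\<C>. card H)"
    using assms card_rcosets_equal subgroup.subset[OF assms(1)] by (intro sum.cong) auto
  finally show ?thesis by simp
qed

text \<open>
  The quantity \<open>d\<close> bounds the number of points in which \<open>F\<close> differs from a union of right cosets,
  from inside as well as from outside: if \<open>f\<close> lies in \<open>F\<close> but \<open>hf\<close> does not, then \<open>hf\<close> is in
  \<open>hF - F\<close> (an excess of the outer union), while \<open>f\<close> is in \<open>F - h\<^sup>-\<^sup>1F\<close> (a loss of the inner one).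
\<close>

lemma card_language_bounds:
  assumes H: "subgroup H G" and fin: "finite H"
    and W: "W \<subseteq> H \<rightarrow>\<^sub>E A" "W \<noteq> {}" "finite W" "shift_invariant G H W"
    and F: "F \<subseteq> carrier G" "finite F"
  defines "X \<equiv> block_shift G A H W"
    and "d \<equiv> (\<Sum>h\<in>H. card (sym_diff (h <#\<^bsub>G\<^esub> F) F))"
  shows "\<bar>real (card H) * ln (card (language F X)) - real (card F) * ln (card W)\<bar> \<le> d * ln (card W)"
proof -
  interpret H: subgroup H G by fact
  define B where "B = (\<Union>h\<in>H. sym_diff (h <#\<^bsub>G\<^esub> F) F)"
  have lF: "finite (h <#\<^bsub>G\<^esub> F)" for h using F by (simp add: l_coset_def)
  have B: "finite B" "card B \<le> d"
    unfolding B_def d_def using fin F lF by (auto intro: card_UN_le)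
  define I where "I = {C \<in> rcosets H. C \<subseteq> F}"
  define J where "J = (\<lambda>u. H #> u) ` F"
  have J: "J \<subseteq> rcosets H" "finite J" using F by (auto simp: J_def RCOSETS_def)
  have "\<Union>I \<subseteq> F" by (auto simp: I_def)
  have I: "I \<subseteq> rcosets H" "finite I"
    using F by (auto simp: I_def intro: finite_subset[of _ "Pow F"])
  have "F \<subseteq> \<Union>J" using F rcos_self[OF _ H] by (auto simp: J_def)
  have out: "\<Union>J \<subseteq> F \<union> B"
    by (auto simp: J_def B_def r_coset_def l_coset_def)
  have inn: "F \<subseteq> \<Union>I \<union> B"
  proof
    fix u assume u: "u \<in> F"
    show "u \<in> \<Union>I \<union> B"
    proof (cases "H #> u \<subseteq> F")
      case True
      then have "H #> u \<in> I" using u F by (auto simp: I_def RCOSETS_def)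
      then show ?thesis using rcos_self[OF _ H] u F by auto
    next
      case False
      then obtain h where h: "h \<in> H" "h \<otimes> u \<notin> F" by (auto simp: r_coset_def)
      have "u \<notin> inv h <#\<^bsub>G\<^esub> F"
      proof
        assume "u \<in> inv h <#\<^bsub>G\<^esub> F"
        then obtain f where f: "f \<in> F" "u = inv h \<otimes> f" by (auto simp: l_coset_def)
        then have "h \<otimes> u = f" using h F by (simp add: subset_iff flip: m_assoc)
        then show False using f h by simp
      qed
      then show ?thesis using u h by (auto simp: B_def)
    qed
  qed
  have cI: "card (language (\<Union>I) X) = card W ^ card I"
    and cJ: "card (language (\<Union>J) X) = card W ^ card J"
    unfolding X_def using card_language_cosets[OF H W(1,2,4)] I J by auto
  have W1: "card W \<ge> 1" using W by (simp add: Suc_le_eq card_gt_0_iff)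
  then have "finite (language (\<Union>J) X)" using cJ by (intro card_ge_0_finite) simp
  then have up: "card (language F X) \<le> card W ^ card J"
    using card_language_mono[OF \<open>F \<subseteq> \<Union>J\<close>] cJ by metis
  have "finite (language F X)"
  proof -
    have "language F X = (\<lambda>z. restrict z F) ` language (\<Union>J) X"
      using \<open>F \<subseteq> \<Union>J\<close> by (simp add: language_def image_image Int_absorb1)
    then show ?thesis using \<open>finite (language (\<Union>J) X)\<close> by simp
  qed
  then have lo: "card W ^ card I \<le> card (language F X)"
    using card_language_mono[OF \<open>\<Union>I \<subseteq> F\<close>] cI by metis
  have L1: "card (language F X) \<ge> 1" using lo W1 by (meson one_le_power order_trans)
  have "card H * card J = card (\<Union>J)" using card_Union_rcosets[OF H fin J(1)] by simp
  also have "\<dots> \<le> card (F \<union> B)" using out F B by (intro card_mono) auto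
  also have "\<dots> \<le> card F + d" using card_Un_le[of F B] B by linarith
  finally have hJ: "card H * card J \<le> card F + d" .
  have "card F \<le> card (\<Union>I \<union> B)"
    using inn B \<open>\<Union>I \<subseteq> F\<close> F by (intro card_mono) (auto intro: finite_subset)
  also have "\<dots> \<le> card H * card I + d"
    using card_Un_le[of "\<Union>I" B] B card_Union_rcosets[OF H fin I(1)] by linarith
  finally have hI: "card F \<le> card H * card I + d" .
  define w where "w = ln (real (card W))"
  define l where "l = ln (real (card (language F X)))"
  have w0: "w \<ge> 0" using W1 by (simp add: w_def)
  have "l \<le> ln (real (card W ^ card J))" unfolding l_def using up L1 by (intro ln_mono) linarith+
  then have l1: "l \<le> card J * w" using W1 by (simp add: w_def ln_realpow)
  have "ln (real (card W ^ card I)) \<le> l" unfolding l_def using lo W1 by (intro ln_mono) (simp_all flip: of_nat_power)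
  then have l2: "card I * w \<le> l" using W1 by (simp add: w_def ln_realpow)
  have "card H * l \<le> card H * (card J * w)" using l1 by (intro mult_left_mono) auto
  also have "\<dots> = real (card H * card J) * w" by simp
  also have "\<dots> \<le> real (card F + d) * w" using hJ w0 by (intro mult_right_mono of_nat_mono) auto
  finally have 1: "card H * l - card F * w \<le> d * w" by (simp add: algebra_simps)
  have "real (card F) * w \<le> real (card H * card I + d) * w"
    using hI w0 by (intro mult_right_mono of_nat_mono) auto
  also have "\<dots> = card H * (card I * w) + d * w" by (simp add: algebra_simps)
  also have "\<dots> \<le> card H * l + d * w" using l2 by (intro add_right_mono mult_left_mono) auto
  finally have "card F * w - card H * l \<le> d * w" by simp
  with 1 show ?thesis unfolding w_def l_def by linarith
qed

section \<open>Entropy\<close>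

text \<open>
  Division of the previous bound by \<open>|F\<^sub>n| |H|\<close> leaves a finite sum, over \<open>H\<close>, of the quotients
  \<open>|hF\<^sub>n \<triangle> F\<^sub>n| / |F\<^sub>n|\<close>, each of which tends to 0.
\<close>

lemma folner_limit_block_shift:
  assumes H: "subgroup H G" and fin: "finite H"
    and W: "W \<subseteq> H \<rightarrow>\<^sub>E A" "W \<noteq> {}" "finite W" "shift_invariant G H W"
    and F: "folner_sequence G F"
  shows "(\<lambda>n. ln (real (card (language (F n) (block_shift G A H W)))) / real (card (F n)))
           \<longlonglongrightarrow> ln (real (card W)) / real (card H)"
proof -
  let ?X = "block_shift G A H W"
  let ?w = "ln (real (card W))"
  interpret H: subgroup H G by fact
  define e where "e n = (\<Sum>h\<in>H. real (card (sym_diff (h <#\<^bsub>G\<^esub> F n) (F n))) / real (card (F n)))" for n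
  have "e \<longlonglongrightarrow> (\<Sum>h\<in>H. 0)"
    unfolding e_def using F by (intro tendsto_sum) (auto simp: folner_sequence_def)
  then have e: "(\<lambda>n. e n * ?w / card H) \<longlonglongrightarrow> 0"
    using tendsto_mult_left_zero[of e sequentially "?w / card H"] by simp
  have h0: "real (card H) > 0"
  proof -
    have "H \<noteq> {}" using subgroup.one_closed[OF H] by blast
    then show ?thesis using fin by (simp add: card_gt_0_iff)
  qed
  have "norm (ln (real (card (language (F n) ?X))) / real (card (F n)) - ?w / card H) \<le> e n * ?w / card H" for n
  proof -
    have Fn: "F n \<subseteq> carrier G" "finite (F n)" "F n \<noteq> {}"
      using F by (auto simp: folner_sequence_def)
    then have f0: "real (card (F n)) > 0" by (simp add: card_gt_0_iff)
    let ?l = "ln (real (card (language (F n) ?X)))"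
    let ?d = "\<Sum>h\<in>H. card (sym_diff (h <#\<^bsub>G\<^esub> F n) (F n))"
    have "?l / real (card (F n)) - ?w / card H
         = (card H * ?l - card (F n) * ?w) / (card (F n) * card H)"
      using f0 h0 by (simp add: field_simps)
    then have "\<bar>?l / real (card (F n)) - ?w / card H\<bar>
         = \<bar>card H * ?l - card (F n) * ?w\<bar> / (card (F n) * card H)"
      using f0 h0 by (simp add: abs_mult)
    also have "\<dots> \<le> (?d * ?w) / (card (F n) * card H)"
      using card_language_bounds[OF H fin W Fn(1,2)] by (intro divide_right_mono) auto
    also have "\<dots> = e n * ?w / card H"
      by (simp add: e_def flip: sum_divide_distrib)
    finally show ?thesis by simp
  qed
  then have "(\<lambda>n. ln (real (card (language (F n) ?X))) / real (card (F n)) - ?w / card H) \<longlonglongrightarrow> 0"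
    using e by (intro Lim_null_comparison[OF _ e]) auto
  then show ?thesis using LIM_zero_iff by blast
qed

text \<open>
  The members of the sequence are finite subgroups, so \<open>gF\<^sub>n\<close> equals \<open>F\<^sub>n\<close> as soon as \<open>F\<^sub>n\<close> contains \<open>g\<close>.
\<close>

lemma folner_sequence_exists:
  assumes lf: "locally_finite G" and cnt: "countable (carrier G)"
  shows "\<exists>F. folner_sequence G F"
proof -
  define a where "a = from_nat_into (carrier G)"
  have ran: "range a = carrier G"
    unfolding a_def using cnt by (intro range_from_nat_into) auto
  define F where "F n = generate G (a ` {..n})" for n
  have sub: "subgroup (F n) G" for n
    unfolding F_def using ran by (intro generate_is_subgroup) auto
  have fin: "finite (F n)" for n
    using lf ran unfolding F_def locally_finite_def by (metis finite_atMost finite_imageI subset_UNIV image_mono)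
  have mem: "a k \<in> F n" if "k \<le> n" for k n
    unfolding F_def using that by (intro generate.incl) auto
  have "folner_sequence G F"
    unfolding folner_sequence_def
  proof (intro conjI allI ballI)
    show "F n \<noteq> {}" for n using subgroup.one_closed[OF sub] by blast
    show "finite (F n)" for n by (rule fin)
    show Fc: "F n \<subseteq> carrier G" for n using subgroup.subset[OF sub] .
    show "(\<Union>n. F n) = carrier G"
    proof (intro equalityI UN_least Fc)
      show "carrier G \<subseteq> (\<Union>n. F n)" unfolding ran[symmetric] using mem by blast
    qed
    fix g assume "g \<in> carrier G"
    then obtain k where k: "g = a k" using ran by blast
    have "g <#\<^bsub>G\<^esub> F n = F n" if "n \<ge> k" for n
      using mem[OF that] sub k by (metis Fc coset_join3 subsetD)
    then have "\<forall>\<^sub>F n in sequentially. real (card (sym_diff (g <#\<^bsub>G\<^esub> F n) (F n))) / real (card (F n)) = 0"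
      by (intro eventually_sequentiallyI[of k]) auto
    then show "(\<lambda>n. real (card (sym_diff (g <#\<^bsub>G\<^esub> F n) (F n))) / real (card (F n))) \<longlonglongrightarrow> 0"
      by (rule tendsto_eventually)
  qed
  then show ?thesis by blast
qed

lemma entropy_block_shift:
  assumes "locally_finite G" "countable (carrier G)"
    and "subgroup H G" "finite H"
    and "W \<subseteq> H \<rightarrow>\<^sub>E A" "W \<noteq> {}" "finite W" "shift_invariant G H W"
  shows "entropy G (block_shift G A H W) = ln (real (card W)) / real (card H)"
  unfolding entropy_def
proof (rule the_equality)
  show "\<forall>F. folner_sequence G F \<longrightarrow> (\<lambda>n. ln (real (card (language (F n) (block_shift G A H W)))) / real (card (F n)))
           \<longlonglongrightarrow> ln (real (card W)) / real (card H)"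
    using folner_limit_block_shift[OF assms(3-8)] by blast
  then show "h = ln (real (card W)) / real (card H)"
    if "\<forall>F. folner_sequence G F \<longrightarrow> (\<lambda>n. ln (real (card (language (F n) (block_shift G A H W)))) / real (card (F n)))
           \<longlonglongrightarrow> h" for h
    using that folner_sequence_exists[OF assms(1,2)] LIMSEQ_unique by blast
qed

end

section \<open>The set of entropies\<close>

theorem mainTheorem3:
  fixes G :: "('g, 'm) monoid_scheme"
  assumes "group G"
    and "countable (carrier G)"
    and "locally_finite G"
  shows "SFT_entropies G =
    {ln (real n) / real (card H) | (n :: nat) H. subgroup H G \<and> finite H \<and> n \<ge> 1}"
proof (intro equalityI subsetI)
  interpret group G by fact
  fix r assume "r \<in> SFT_entropies G"
  then obtain A :: "nat set" and X where A: "finite A" and X: "is_SFT G A X" "X \<noteq> {}"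
    and r: "r = entropy G X"
    by (auto simp: SFT_entropies_def)
  obtain P where "finite P" "P \<subseteq> finite_patterns G A" "X = avoiding G A P"
    using X by (auto simp: is_SFT_def)
  then obtain H W where H: "subgroup H G" "finite H" and W: "W \<subseteq> H \<rightarrow>\<^sub>E A" "shift_invariant G H W"
    and eq: "X = block_shift G A H W"
    using avoiding_eq_block_shift[OF assms(3)] by metis
  have "W \<noteq> {}" using X eq by (auto simp: block_shift_def)
  moreover have "finite W" using W(1) H A by (meson finite_PiE finite_subset)
  ultimately have "r = ln (real (card W)) / real (card H)" "card W \<ge> 1"
    using r eq entropy_block_shift[OF assms(3,2) H W(1) _ _ W(2)]
    by (auto simp: Suc_le_eq card_gt_0_iff)
  then show "r \<in> {ln (real n) / real (card H) | (n :: nat) H. subgroup H G \<and> finite H \<and> n \<ge> 1}"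
    using H by blast
next
  interpret group G by fact
  fix r assume "r \<in> {ln (real n) / real (card H) | (n :: nat) H. subgroup H G \<and> finite H \<and> n \<ge> 1}"
  then obtain n :: nat and H where H: "subgroup H G" "finite H" and n: "n \<ge> 1"
    and r: "r = ln (real n) / real (card H)" by blast
  interpret H: subgroup H G by fact
  define W where "W = (\<lambda>a. \<lambda>h\<in>H. a) ` {..<n}"
  have "inj_on (\<lambda>a. \<lambda>h\<in>H. a) {..<n}"
    by (rule inj_onI) (metis H.one_closed restrict_apply')
  then have cW: "card W = n" by (simp add: W_def card_image)
  have W: "W \<subseteq> H \<rightarrow>\<^sub>E {..<n}" "W \<noteq> {}" "finite W" using n by (auto simp: W_def lessThan_empty_iff bot_nat_def)
  have inv: "shift_invariant G H W"
    unfolding shift_invariant_def W_def by (auto simp: image_iff fun_eq_iff)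
  define X where "X = block_shift G {..<n} H W"
  have "(\<lambda>g\<in>carrier G. 0) \<in> X"
    using n by (auto simp: X_def block_shift_def W_def shift_map_def fun_eq_iff image_iff)
  moreover have "is_SFT G {..<n} X" unfolding X_def using H by (intro is_SFT_block_shift) auto
  moreover have "entropy G X = r"
    unfolding X_def r using entropy_block_shift[OF assms(3,2) H W inv] cW by simp
  ultimately show "r \<in> SFT_entropies G"
    unfolding SFT_entropies_def by blast
qed

end
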